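(* Let $D$ be an associative dialgebra over $\phi$ and let $*$ be an involution of $D$. Then $D$ with the triple products $$\{a,b,c\}_1:=a\dashv(b^*\dashv c),\quad \{a,b,c\}_2:=a\vdash(b^*\dashv c),\quad \{a,b,c\}_3:=a\vdash(b^*\vdash c)\qquad (a,b,c\in D)$$ is an associative triple trisystem of the second kind.
   Context: $\phi$ is a scalar ring (commutative, unital) with $\frac12\in\phi$. An associative dialgebra is a $\phi$-module $D$ with two bilinear products $\dashv,\vdash$ satisfying, for all $a,b,c\in D$: $(a\dashv b)\dashv c=a\dashv(b\dashv c)$; $(a\vdash b)\dashv c=a\vdash(b\dashv c)$; $(a\vdash b)\vdash c=a\vdash(b\vdash c)$; $a\dashv(b\dashv c)=a\dashv(b\vdash c)$; $(a\dashv b)\vdash c=(a\vdash b)\vdash c$. An involution of $D$ is a linear map $*:D\to D$ with $(a^* )^*=a$, $(a\dashv b)^*=b^*\vdash a^*$ and $(a\vdash b)^*=b^*\dashv a^*$ for all $a,b\in D$. An associative triple trisystem of the second kind is a $\phi$-module $A$ with three trilinear maps $\{\,,\,,\,\}_i:A\times A\times A\to A$, $i\in\{1,2,3\}$, satisfying for all $a,b,c,d,e\in A$: (1) $\{\{a,b,c\}_1,d,e\}_1=\{a,\{d,c,b\}_1,e\}_1=\{a,b,\{c,d,e\}_1\}_1$; (2) $\{\{a,b,c\}_2,d,e\}_1=\{a,\{d,c,b\}_3,e\}_2=\{a,b,\{c,d,e\}_1\}_2$; (3) $\{\{a,b,c\}_3,d,e\}_1=\{a,\{d,c,b\}_2,e\}_2=\{a,b,\{c,d,e\}_1\}_3$;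 (4) $\{\{a,b,c\}_3,d,e\}_2=\{a,\{d,c,b\}_1,e\}_2=\{a,b,\{c,d,e\}_2\}_3$; (5) $\{\{a,b,c\}_3,d,e\}_3=\{a,\{d,c,b\}_3,e\}_3=\{a,b,\{c,d,e\}_3\}_3$; (6) $\{\{a,b,c\}_1,d,e\}_2=\{\{a,b,c\}_2,d,e\}_2=\{\{a,b,c\}_3,d,e\}_2$; (7) $\{\{a,b,c\}_1,d,e\}_3=\{\{a,b,c\}_2,d,e\}_3=\{\{a,b,c\}_3,d,e\}_3$; (8) $\{a,\{b,c,d\}_1,e\}_1=\{a,\{b,c,d\}_2,e\}_1=\{a,\{b,c,d\}_3,e\}_1$; (9) $\{a,\{b,c,d\}_1,e\}_3=\{a,\{b,c,d\}_2,e\}_3=\{a,\{b,c,d\}_3,e\}_3$; (10) $\{a,b,\{c,d,e\}_1\}_1=\{a,b,\{c,d,e\}_2\}_1=\{a,b,\{c,d,e\}_3\}_1$; (11) $\{a,b,\{c,d,e\}_1\}_2=\{a,b,\{c,d,e\}_2\}_2=\{a,b,\{c,d,e\}_3\}_2$. *)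

theory Defs
  imports "HOL-Algebra.Module"
begin

text \<open>Invertibility of 2 is understood in the ring itself, so the zero ring is not excluded.\<close>

locale scalar_ring = cring R for R (structure) +
  assumes half_exists: "\<one> \<oplus> \<one> \<in> Units R"

locale scalar_module = scalar_ring R + module R M
  for R :: "('r, 's) ring_scheme" (structure) and M :: "('r, 'a, 'm) module_scheme" (structure)

text \<open>Maps are constrained on the carrier only. Of the record \<open>M\<close>, only the additive
  group and the scalar action are used; the fields \<open>mult\<close> and \<open>one\<close> stay arbitrary.\<close>

definition linear_map ::
  "('r, 's) ring_scheme \<Rightarrow> ('r, 'a, 'm) module_scheme \<Rightarrow> ('a \<Rightarrow> 'a) \<Rightarrow> bool"
where
  "linear_map R M f \<longleftrightarrow>
     (\<forall>x \<in> carrier M. f x \<in> carrier M) \<and>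
     (\<forall>x \<in> carrier M. \<forall>y \<in> carrier M. f (x \<oplus>\<^bsub>M\<^esub> y) = f x \<oplus>\<^bsub>M\<^esub> f y) \<and>
     (\<forall>r \<in> carrier R. \<forall>x \<in> carrier M. f (r \<odot>\<^bsub>M\<^esub> x) = r \<odot>\<^bsub>M\<^esub> f x)"

definition bilinear_map ::
  "('r, 's) ring_scheme \<Rightarrow> ('r, 'a, 'm) module_scheme \<Rightarrow> ('a \<Rightarrow> 'a \<Rightarrow> 'a) \<Rightarrow> bool"
where
  "bilinear_map R M f \<longleftrightarrow>
     (\<forall>a \<in> carrier M. linear_map R M (\<lambda>x. f a x) \<and> linear_map R M (\<lambda>x. f x a))"

definition trilinear_map ::
  "('r, 's) ring_scheme \<Rightarrow> ('r, 'a, 'm) module_scheme \<Rightarrow> ('a \<Rightarrow> 'a \<Rightarrow> 'a \<Rightarrow> 'a) \<Rightarrow> bool"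
where
  "trilinear_map R M f \<longleftrightarrow>
     (\<forall>a \<in> carrier M. \<forall>b \<in> carrier M.
        linear_map R M (\<lambda>x. f x a b) \<and> linear_map R M (\<lambda>x. f a x b) \<and>
        linear_map R M (\<lambda>x. f a b x))"

locale associative_dialgebra = scalar_module R D
  for R :: "('r, 's) ring_scheme" (structure) and D :: "('r, 'a, 'm) module_scheme" (structure) +
  fixes ldash :: "'a \<Rightarrow> 'a \<Rightarrow> 'a" (infix "\<stileturn>" 70)
    and rdash :: "'a \<Rightarrow> 'a \<Rightarrow> 'a" (infix "\<turnstile>" 70)
  assumes bilinear_ldash: "bilinear_map R D (\<stileturn>)"
    and bilinear_rdash: "bilinear_map R D (\<turnstile>)"
    and assoc_ll: "\<lbrakk>a \<in> carrier D; b \<in> carrier D; c \<in> carrier D\<rbrakk> \<Longrightarrow>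
      (a \<stileturn> b) \<stileturn> c = a \<stileturn> (b \<stileturn> c)"
    and assoc_rl: "\<lbrakk>a \<in> carrier D; b \<in> carrier D; c \<in> carrier D\<rbrakk> \<Longrightarrow>
      (a \<turnstile> b) \<stileturn> c = a \<turnstile> (b \<stileturn> c)"
    and assoc_rr: "\<lbrakk>a \<in> carrier D; b \<in> carrier D; c \<in> carrier D\<rbrakk> \<Longrightarrow>
      (a \<turnstile> b) \<turnstile> c = a \<turnstile> (b \<turnstile> c)"
    and bar_left: "\<lbrakk>a \<in> carrier D; b \<in> carrier D; c \<in> carrier D\<rbrakk> \<Longrightarrow>
      a \<stileturn> (b \<stileturn> c) = a \<stileturn> (b \<turnstile> c)"
    and bar_right: "\<lbrakk>a \<in> carrier D; b \<in> carrier D; c \<in> carrier D\<rbrakk> \<Longrightarrow>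
      (a \<stileturn> b) \<turnstile> c = (a \<turnstile> b) \<turnstile> c"

locale dialgebra_involution = associative_dialgebra R D ldash rdash
  for R :: "('r, 's) ring_scheme" (structure) and D :: "('r, 'a, 'm) module_scheme" (structure)
    and ldash :: "'a \<Rightarrow> 'a \<Rightarrow> 'a" (infix "\<stileturn>" 70)
    and rdash :: "'a \<Rightarrow> 'a \<Rightarrow> 'a" (infix "\<turnstile>" 70) +
  fixes star :: "'a \<Rightarrow> 'a"
  assumes linear_star: "linear_map R D star"
    and star_star: "a \<in> carrier D \<Longrightarrow> star (star a) = a"
    and star_ldash: "\<lbrakk>a \<in> carrier D; b \<in> carrier D\<rbrakk> \<Longrightarrow> star (a \<stileturn> b) = star b \<turnstile> star a"
    and star_rdash: "\<lbrakk>a \<in> carrier D; b \<in> carrier D\<rbrakk> \<Longrightarrow> star (a \<turnstile> b) = star b \<stileturn> star a"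

locale associative_triple_trisystem_2nd = scalar_module R A
  for R :: "('r, 's) ring_scheme" (structure) and A :: "('r, 'a, 'm) module_scheme" (structure) +
  fixes triple1 :: "'a \<Rightarrow> 'a \<Rightarrow> 'a \<Rightarrow> 'a" ("\<lbrace>_, _, _\<rbrace>\<^sub>1")
    and triple2 :: "'a \<Rightarrow> 'a \<Rightarrow> 'a \<Rightarrow> 'a" ("\<lbrace>_, _, _\<rbrace>\<^sub>2")
    and triple3 :: "'a \<Rightarrow> 'a \<Rightarrow> 'a \<Rightarrow> 'a" ("\<lbrace>_, _, _\<rbrace>\<^sub>3")
  assumes trilinear1: "trilinear_map R A triple1"
    and trilinear2: "trilinear_map R A triple2"
    and trilinear3: "trilinear_map R A triple3"
    and assoc_1: "\<lbrakk>a \<in> carrier A; b \<in> carrier A; c \<in> carrier A; d \<in> carrier A; e \<in> carrier A\<rbrakk> \<Longrightarrow>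
      \<lbrace>\<lbrace>a, b, c\<rbrace>\<^sub>1, d, e\<rbrace>\<^sub>1 = \<lbrace>a, \<lbrace>d, c, b\<rbrace>\<^sub>1, e\<rbrace>\<^sub>1 \<and>
      \<lbrace>a, \<lbrace>d, c, b\<rbrace>\<^sub>1, e\<rbrace>\<^sub>1 = \<lbrace>a, b, \<lbrace>c, d, e\<rbrace>\<^sub>1\<rbrace>\<^sub>1"
    and assoc_2: "\<lbrakk>a \<in> carrier A; b \<in> carrier A; c \<in> carrier A; d \<in> carrier A; e \<in> carrier A\<rbrakk> \<Longrightarrow>
      \<lbrace>\<lbrace>a, b, c\<rbrace>\<^sub>2, d, e\<rbrace>\<^sub>1 = \<lbrace>a, \<lbrace>d, c, b\<rbrace>\<^sub>3, e\<rbrace>\<^sub>2 \<and>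
      \<lbrace>a, \<lbrace>d, c, b\<rbrace>\<^sub>3, e\<rbrace>\<^sub>2 = \<lbrace>a, b, \<lbrace>c, d, e\<rbrace>\<^sub>1\<rbrace>\<^sub>2"
    and assoc_3: "\<lbrakk>a \<in> carrier A; b \<in> carrier A; c \<in> carrier A; d \<in> carrier A; e \<in> carrier A\<rbrakk> \<Longrightarrow>
      \<lbrace>\<lbrace>a, b, c\<rbrace>\<^sub>3, d, e\<rbrace>\<^sub>1 = \<lbrace>a, \<lbrace>d, c, b\<rbrace>\<^sub>2, e\<rbrace>\<^sub>2 \<and>
      \<lbrace>a, \<lbrace>d, c, b\<rbrace>\<^sub>2, e\<rbrace>\<^sub>2 = \<lbrace>a, b, \<lbrace>c, d, e\<rbrace>\<^sub>1\<rbrace>\<^sub>3"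
    and assoc_4: "\<lbrakk>a \<in> carrier A; b \<in> carrier A; c \<in> carrier A; d \<in> carrier A; e \<in> carrier A\<rbrakk> \<Longrightarrow>
      \<lbrace>\<lbrace>a, b, c\<rbrace>\<^sub>3, d, e\<rbrace>\<^sub>2 = \<lbrace>a, \<lbrace>d, c, b\<rbrace>\<^sub>1, e\<rbrace>\<^sub>2 \<and>
      \<lbrace>a, \<lbrace>d, c, b\<rbrace>\<^sub>1, e\<rbrace>\<^sub>2 = \<lbrace>a, b, \<lbrace>c, d, e\<rbrace>\<^sub>2\<rbrace>\<^sub>3"
    and assoc_5: "\<lbrakk>a \<in> carrier A; b \<in> carrier A; c \<in> carrier A; d \<in> carrier A; e \<in> carrier A\<rbrakk> \<Longrightarrow>
      \<lbrace>\<lbrace>a, b, c\<rbrace>\<^sub>3, d, e\<rbrace>\<^sub>3 = \<lbrace>a, \<lbrace>d, c, b\<rbrace>\<^sub>3, e\<rbrace>\<^sub>3 \<and>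
      \<lbrace>a, \<lbrace>d, c, b\<rbrace>\<^sub>3, e\<rbrace>\<^sub>3 = \<lbrace>a, b, \<lbrace>c, d, e\<rbrace>\<^sub>3\<rbrace>\<^sub>3"
    and bar_left_2: "\<lbrakk>a \<in> carrier A; b \<in> carrier A; c \<in> carrier A; d \<in> carrier A; e \<in> carrier A\<rbrakk> \<Longrightarrow>
      \<lbrace>\<lbrace>a, b, c\<rbrace>\<^sub>1, d, e\<rbrace>\<^sub>2 = \<lbrace>\<lbrace>a, b, c\<rbrace>\<^sub>2, d, e\<rbrace>\<^sub>2 \<and>
      \<lbrace>\<lbrace>a, b, c\<rbrace>\<^sub>2, d, e\<rbrace>\<^sub>2 = \<lbrace>\<lbrace>a, b, c\<rbrace>\<^sub>3, d, e\<rbrace>\<^sub>2"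
    and bar_left_3: "\<lbrakk>a \<in> carrier A; b \<in> carrier A; c \<in> carrier A; d \<in> carrier A; e \<in> carrier A\<rbrakk> \<Longrightarrow>
      \<lbrace>\<lbrace>a, b, c\<rbrace>\<^sub>1, d, e\<rbrace>\<^sub>3 = \<lbrace>\<lbrace>a, b, c\<rbrace>\<^sub>2, d, e\<rbrace>\<^sub>3 \<and>
      \<lbrace>\<lbrace>a, b, c\<rbrace>\<^sub>2, d, e\<rbrace>\<^sub>3 = \<lbrace>\<lbrace>a, b, c\<rbrace>\<^sub>3, d, e\<rbrace>\<^sub>3"
    and bar_mid_1: "\<lbrakk>a \<in> carrier A; b \<in> carrier A; c \<in> carrier A; d \<in> carrier A; e \<in> carrier A\<rbrakk> \<Longrightarrow>
      \<lbrace>a, \<lbrace>b, c, d\<rbrace>\<^sub>1, e\<rbrace>\<^sub>1 = \<lbrace>a, \<lbrace>b, c, d\<rbrace>\<^sub>2, e\<rbrace>\<^sub>1 \<and>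
      \<lbrace>a, \<lbrace>b, c, d\<rbrace>\<^sub>2, e\<rbrace>\<^sub>1 = \<lbrace>a, \<lbrace>b, c, d\<rbrace>\<^sub>3, e\<rbrace>\<^sub>1"
    and bar_mid_3: "\<lbrakk>a \<in> carrier A; b \<in> carrier A; c \<in> carrier A; d \<in> carrier A; e \<in> carrier A\<rbrakk> \<Longrightarrow>
      \<lbrace>a, \<lbrace>b, c, d\<rbrace>\<^sub>1, e\<rbrace>\<^sub>3 = \<lbrace>a, \<lbrace>b, c, d\<rbrace>\<^sub>2, e\<rbrace>\<^sub>3 \<and>
      \<lbrace>a, \<lbrace>b, c, d\<rbrace>\<^sub>2, e\<rbrace>\<^sub>3 = \<lbrace>a, \<lbrace>b, c, d\<rbrace>\<^sub>3, e\<rbrace>\<^sub>3"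
    and bar_right_1: "\<lbrakk>a \<in> carrier A; b \<in> carrier A; c \<in> carrier A; d \<in> carrier A; e \<in> carrier A\<rbrakk> \<Longrightarrow>
      \<lbrace>a, b, \<lbrace>c, d, e\<rbrace>\<^sub>1\<rbrace>\<^sub>1 = \<lbrace>a, b, \<lbrace>c, d, e\<rbrace>\<^sub>2\<rbrace>\<^sub>1 \<and>
      \<lbrace>a, b, \<lbrace>c, d, e\<rbrace>\<^sub>2\<rbrace>\<^sub>1 = \<lbrace>a, b, \<lbrace>c, d, e\<rbrace>\<^sub>3\<rbrace>\<^sub>1"
    and bar_right_2: "\<lbrakk>a \<in> carrier A; b \<in> carrier A; c \<in> carrier A; d \<in> carrier A; e \<in> carrier A\<rbrakk> \<Longrightarrow>
      \<lbrace>a, b, \<lbrace>c, d, e\<rbrace>\<^sub>1\<rbrace>\<^sub>2 = \<lbrace>a, b, \<lbrace>c, d, e\<rbrace>\<^sub>2\<rbrace>\<^sub>2 \<and>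
      \<lbrace>a, b, \<lbrace>c, d, e\<rbrace>\<^sub>2\<rbrace>\<^sub>2 = \<lbrace>a, b, \<lbrace>c, d, e\<rbrace>\<^sub>3\<rbrace>\<^sub>2"

end

theory Submission
  imports Defs
begin

text \<open>A dialgebra monomial depends only on the word of its factors and on the position of
  its central factor, reached from the root by going left at \<open>\<stileturn>\<close> and right at
  \<open>\<turnstile>\<close>; its normal form is
  \<open>x\<^sub>1 \<turnstile> (\<dots> \<turnstile> (x\<^sub>i \<stileturn> (\<dots> \<stileturn> x\<^sub>n)))\<close> with \<open>x\<^sub>i\<close> central. The
  involution reverses the word and keeps the central factor, so the monomials in each trisystem
  identity have the same normal form.\<close>

lemma linear_map_compose:
  "\<lbrakk>linear_map R M f; linear_map R M g\<rbrakk> \<Longrightarrow> linear_map R M (\<lambda>x. f (g x))"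
  by (simp add: linear_map_def)

lemma linear_map_closed: "\<lbrakk>linear_map R M f; x \<in> carrier M\<rbrakk> \<Longrightarrow> f x \<in> carrier M"
  by (simp add: linear_map_def)

lemma bilinear_mapD:
  assumes "bilinear_map R M f" and "a \<in> carrier M"
  shows "linear_map R M (\<lambda>x. f a x)" and "linear_map R M (\<lambda>x. f x a)"
  using assms by (simp_all add: bilinear_map_def)

lemma bilinear_map_closed:
  "\<lbrakk>bilinear_map R M f; x \<in> carrier M; y \<in> carrier M\<rbrakk> \<Longrightarrow> f x y \<in> carrier M"
  using bilinear_mapD(1) linear_map_closed by metis

text \<open>All three triple products have this shape, with \<open>s\<close> the involution. Fixing
  two arguments leaves a composite of one-variable sections of \<open>f\<close> and
  \<open>g\<close>, and of \<open>s\<close> in the middle slot.\<close>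

lemma trilinear_map_twisted:
  assumes f: "bilinear_map R M f" and g: "bilinear_map R M g" and s: "linear_map R M s"
  shows "trilinear_map R M (\<lambda>a b c. f a (g (s b) c))"
proof -
  have "linear_map R M (\<lambda>x. f x (g (s a) b)) \<and> linear_map R M (\<lambda>x. f a (g (s x) b)) \<and>
      linear_map R M (\<lambda>x. f a (g (s b) x))"
    if a: "a \<in> carrier M" and b: "b \<in> carrier M" for a b
  proof (intro conjI)
    have sa: "s a \<in> carrier M" and sb: "s b \<in> carrier M"
      using linear_map_closed[OF s] a b by auto
    show "linear_map R M (\<lambda>x. f x (g (s a) b))"
      using bilinear_mapD(2)[OF f bilinear_map_closed[OF g sa b]] .
    show "linear_map R M (\<lambda>x. f a (g (s x) b))"
      using linear_map_compose[OF bilinear_mapD(1)[OF f a]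
          linear_map_compose[OF bilinear_mapD(2)[OF g b] s]] .
    show "linear_map R M (\<lambda>x. f a (g (s b) x))"
      using linear_map_compose[OF bilinear_mapD(1)[OF f a] bilinear_mapD(1)[OF g sb]] .
  qed
  then show ?thesis
    by (simp add: trilinear_map_def)
qed

context associative_dialgebra
begin

lemma ldash_closed: "\<lbrakk>a \<in> carrier D; b \<in> carrier D\<rbrakk> \<Longrightarrow> a \<stileturn> b \<in> carrier D"
  using bilinear_map_closed[OF bilinear_ldash] .

lemma rdash_closed: "\<lbrakk>a \<in> carrier D; b \<in> carrier D\<rbrakk> \<Longrightarrow> a \<turnstile> b \<in> carrier D"
  using bilinear_map_closed[OF bilinear_rdash] .

lemma assoc_lr:
  "\<lbrakk>a \<in> carrier D; b \<in> carrier D; c \<in> carrier D\<rbrakk> \<Longrightarrow> (a \<stileturn> b) \<turnstile> c = a \<turnstile> (b \<turnstile> c)"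
  by (simp add: bar_right assoc_rr)

text \<open>Oriented to nest products to the right. \<open>bar_left\<close> is reversed so that
  everything right of the central factor is joined by \<open>\<stileturn>\<close>.\<close>

lemmas dialgebra_normalize =
  assoc_ll assoc_rl assoc_rr assoc_lr bar_left[symmetric] ldash_closed rdash_closed

end

theorem proposition4:
  fixes R :: "('r, 's) ring_scheme" and D :: "('r, 'a, 'm) module_scheme"
    and ldash :: "'a \<Rightarrow> 'a \<Rightarrow> 'a" (infix "\<stileturn>" 70)
    and rdash :: "'a \<Rightarrow> 'a \<Rightarrow> 'a" (infix "\<turnstile>" 70)
    and star :: "'a \<Rightarrow> 'a"
  assumes "associative_dialgebra R D (\<stileturn>) (\<turnstile>)"
    and "dialgebra_involution R D (\<stileturn>) (\<turnstile>) star"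
  shows "associative_triple_trisystem_2nd R D
    (\<lambda>a b c. a \<stileturn> (star b \<stileturn> c))
    (\<lambda>a b c. a \<turnstile> (star b \<stileturn> c))
    (\<lambda>a b c. a \<turnstile> (star b \<turnstile> c))"
proof -
  interpret dialgebra_involution R D "(\<stileturn>)" "(\<turnstile>)" star
    by fact
  \<comment> \<open>Pushes \<open>star\<close> down to single factors; \<open>star_star\<close>
    clears the double stars arising from a triple product in the middle slot.\<close>
  note rules = dialgebra_normalize star_ldash star_rdash star_star linear_map_closed[OF linear_star]
  show ?thesis
    by unfold_locales
      (use trilinear_map_twisted bilinear_ldash bilinear_rdash linear_star in blast
        | simp add: rules)+
qed

end
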